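(* Let $\alpha$ be a Frenet curve in $E^3$ with Frenet frame $\{T,N,B\}$, curvature $\kappa$ and torsion $\tau$, and let $\beta$ be a Mannheim-direction curve of $\alpha$ with curvature $\overline\kappa$ and torsion $\overline\tau$. Let $\int\kappa\,ds$ denote the antiderivative of $\kappa$ (determined modulo $2\pi$) for which $\beta'=\sin\left(\int\kappa\,ds\right)T+\cos\left(\int\kappa\,ds\right)N$. Then $$\overline\kappa=\left|\tau\cos\left(\int\kappa\,ds\right)\right|,\qquad \overline\tau=\tau\sin\left(\int\kappa\,ds\right),$$ $$\kappa=\left|\frac{\overline\kappa^2}{\overline\kappa^2+\overline\tau^2}\left(\frac{\overline\tau}{\overline\kappa}\right)'\right|,\qquad |\tau|=\sqrt{\overline\kappa^2+\overline\tau^2}.$$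
   Context: $I\subset\mathbb{R}$ is an open interval and curves are smooth. A unit speed curve $\alpha:I\to E^3$ is a Frenet curve if its curvature $\kappa=\|\alpha''\|$ is nowhere zero; then $T=\alpha'$, $N=\alpha''/\kappa$, $B=T\times N$, and $T'=\kappa N$, $N'=-\kappa T+\tau B$, $B'=-\tau N$, where $\tau$ is the torsion. For a unit vector field $X(s)=a(s)T(s)+b(s)N(s)+c(s)B(s)$ with $a,b,c$ smooth and $a^2+b^2+c^2=1$, an $X$-direction curve of $\alpha$ is a curve $\beta:I\to E^3$ with $\beta'(s)=X(s)$; the parameter $s$ is then also arc length for $\beta$. The Frenet apparatus of $\beta$ is defined in the same way and denoted $\{\overline T,\overline N,\overline B\},\overline\kappa,\overline\tau$. An $X$-direction curve $\beta$ of $\alpha$ (for some such $X$) is called a Mannheim-direction curve of $\alpha$ if $\beta$ is a Mannheim curve of $\alpha$ (and $\alpha$ a Mannheim partner curve of $\beta$), in the sense that $\beta$ is a Frenet curve with $\overline N=B$ at each common parameter value $s$. In that case $\beta'=\sin\left(\int\kappa\,ds\right)T+\cos\left(\int\kappa\,ds\right)N$ for some antiderivative of $\kappa$. Primes denote $d/ds$. *)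

theory Defs
  imports "HOL-Analysis.Analysis"
begin

unbundle cross3_syntax

text \<open>
  Curves and functions on an open interval \<open>I\<close> are total functions on \<open>real\<close>; only their values
  on \<open>I\<close> matter. As \<open>I\<close> is open, the derivative \<open>(at s)\<close> at \<open>s \<in> I\<close> depends only on those values.
\<close>

definition open_interval :: "real set \<Rightarrow> bool" where
  "open_interval I \<longleftrightarrow> open I \<and> is_interval I \<and> I \<noteq> {}"

definition vderiv :: "(real \<Rightarrow> 'a::real_normed_vector) \<Rightarrow> real \<Rightarrow> 'a" where
  "vderiv f s = vector_derivative f (at s)"

text \<open>\<open>C\<close>-infinity: all iterated derivatives exist and are differentiable at every point of \<open>I\<close>.\<close>

definition smooth_on :: "real set \<Rightarrow> (real \<Rightarrow> 'a::real_normed_vector) \<Rightarrow> bool" where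
  "smooth_on I f \<longleftrightarrow> (\<forall>n. \<forall>s\<in>I. (vderiv ^^ n) f differentiable (at s))"

definition curvature :: "(real \<Rightarrow> real^3) \<Rightarrow> real \<Rightarrow> real" where
  "curvature \<alpha> s = norm (vderiv (vderiv \<alpha>) s)"

definition tangent :: "(real \<Rightarrow> real^3) \<Rightarrow> real \<Rightarrow> real^3" where
  "tangent \<alpha> = vderiv \<alpha>"

definition principal_normal :: "(real \<Rightarrow> real^3) \<Rightarrow> real \<Rightarrow> real^3" where
  "principal_normal \<alpha> s = vderiv (vderiv \<alpha>) s /\<^sub>R curvature \<alpha> s"

definition binormal :: "(real \<Rightarrow> real^3) \<Rightarrow> real \<Rightarrow> real^3" where
  "binormal \<alpha> s = tangent \<alpha> s \<times> principal_normal \<alpha> s"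

text \<open>
  The torsion is the coefficient in the Frenet formula \<open>B' = - \<tau> N\<close>, read off with the unit vector
  \<open>N\<close>; that this formula holds for Frenet curves is \<open>frenet_binormal\<close> below.
\<close>

definition torsion :: "(real \<Rightarrow> real^3) \<Rightarrow> real \<Rightarrow> real" where
  "torsion \<alpha> s = - (vderiv (binormal \<alpha>) s \<bullet> principal_normal \<alpha> s)"

definition frenet_curve :: "real set \<Rightarrow> (real \<Rightarrow> real^3) \<Rightarrow> bool" where
  "frenet_curve I \<alpha> \<longleftrightarrow>
     smooth_on I \<alpha> \<and> (\<forall>s\<in>I. norm (vderiv \<alpha> s) = 1) \<and> (\<forall>s\<in>I. curvature \<alpha> s \<noteq> 0)"

definition unit_field_along :: "real set \<Rightarrow> (real \<Rightarrow> real^3) \<Rightarrow> (real \<Rightarrow> real^3) \<Rightarrow> bool" where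
  "unit_field_along I \<alpha> X \<longleftrightarrow>
     (\<exists>a b c. smooth_on I a \<and> smooth_on I b \<and> smooth_on I c \<and>
        (\<forall>s\<in>I. (a s)\<^sup>2 + (b s)\<^sup>2 + (c s)\<^sup>2 = 1 \<and>
           X s = a s *\<^sub>R tangent \<alpha> s + b s *\<^sub>R principal_normal \<alpha> s + c s *\<^sub>R binormal \<alpha> s))"

definition direction_curve ::
  "real set \<Rightarrow> (real \<Rightarrow> real^3) \<Rightarrow> (real \<Rightarrow> real^3) \<Rightarrow> (real \<Rightarrow> real^3) \<Rightarrow> bool" where
  "direction_curve I \<alpha> X \<beta> \<longleftrightarrow>
     unit_field_along I \<alpha> X \<and> smooth_on I \<beta> \<and> (\<forall>s\<in>I. (\<beta> has_vector_derivative X s) (at s))"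

definition mannheim_direction_curve ::
  "real set \<Rightarrow> (real \<Rightarrow> real^3) \<Rightarrow> (real \<Rightarrow> real^3) \<Rightarrow> bool" where
  "mannheim_direction_curve I \<alpha> \<beta> \<longleftrightarrow>
     (\<exists>X. direction_curve I \<alpha> X \<beta>) \<and>
     frenet_curve I \<beta> \<and> (\<forall>s\<in>I. principal_normal \<beta> s = binormal \<alpha> s)"

text \<open>
  \<open>\<theta>\<close> is an antiderivative of the curvature of \<open>\<alpha>\<close> with \<open>\<beta>' = sin \<theta> T + cos \<theta> N\<close>.
\<close>

definition mannheim_angle ::
  "real set \<Rightarrow> (real \<Rightarrow> real^3) \<Rightarrow> (real \<Rightarrow> real^3) \<Rightarrow> (real \<Rightarrow> real) \<Rightarrow> bool" where
  "mannheim_angle I \<alpha> \<beta> \<theta> \<longleftrightarrow>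
     (\<forall>s\<in>I. (\<theta> has_real_derivative curvature \<alpha> s) (at s)) \<and>
     (\<forall>s\<in>I. (\<beta> has_vector_derivative
        sin (\<theta> s) *\<^sub>R tangent \<alpha> s + cos (\<theta> s) *\<^sub>R principal_normal \<alpha> s) (at s))"

lemma smooth_on_has_vderiv:
  assumes "smooth_on I f" "s \<in> I"
  shows "(f has_vector_derivative vderiv f s) (at s)"
    and "(vderiv f has_vector_derivative vderiv (vderiv f) s) (at s)"
    and "vderiv (vderiv f) differentiable (at s)"
proof -
  have d: "(vderiv ^^ n) f differentiable (at s)" for n
    using assms unfolding smooth_on_def by blast
  show "(f has_vector_derivative vderiv f s) (at s)"
    using d[of 0] by (simp add: vderiv_def vector_derivative_works)
  show "(vderiv f has_vector_derivative vderiv (vderiv f) s) (at s)"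
    using d[of 1] by (simp add: vderiv_def[of "vderiv f"] vector_derivative_works)
  show "vderiv (vderiv f) differentiable (at s)"
    using d[of 2] by (simp add: numeral_2_eq_2)
qed

lemma inner_derivative_const:
  fixes f g :: "real \<Rightarrow> real^3"
  assumes "open I" "s \<in> I" "\<And>t. t \<in> I \<Longrightarrow> f t \<bullet> g t = k"
    and f: "(f has_vector_derivative f') (at s)" and g: "(g has_vector_derivative g') (at s)"
  shows "f' \<bullet> g s + f s \<bullet> g' = 0"
proof -
  have "((\<lambda>t. f t \<bullet> g t) has_vector_derivative f s \<bullet> g' + f' \<bullet> g s) (at s)"
    by (rule bounded_bilinear.has_vector_derivative[OF bounded_bilinear_inner f g])
  moreover have "((\<lambda>t. f t \<bullet> g t) has_vector_derivative 0) (at s)"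
    by (rule has_vector_derivative_transform_within_open[OF _ assms(1,2), of "\<lambda>_. k"])
       (auto simp: assms(3))
  ultimately show ?thesis
    by (metis vector_derivative_at add.commute)
qed

theorem frenet_binormal:
  assumes I: "open_interval I" and \<alpha>: "frenet_curve I \<alpha>" and s: "s \<in> I"
  shows "(binormal \<alpha> has_vector_derivative - torsion \<alpha> s *\<^sub>R principal_normal \<alpha> s) (at s)"
proof -
  let ?T = "tangent \<alpha>" and ?N = "principal_normal \<alpha>" and ?B = "binormal \<alpha>"
  have op: "open I" using I by (simp add: open_interval_def)
  have sm: "smooth_on I \<alpha>" and unit: "\<And>t. t \<in> I \<Longrightarrow> norm (?T t) = 1"
    and k0: "\<And>t. t \<in> I \<Longrightarrow> curvature \<alpha> t \<noteq> 0"
    using \<alpha> by (auto simp: frenet_curve_def tangent_def)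
  have TT: "?T t \<bullet> ?T t = 1" if "t \<in> I" for t
    using unit[OF that] by (simp add: dot_square_norm)
  have NN: "?N t \<bullet> ?N t = 1" if "t \<in> I" for t
    using k0[OF that]
    by (simp add: principal_normal_def dot_square_norm curvature_def power2_eq_square)
  have dT: "(?T has_vector_derivative curvature \<alpha> t *\<^sub>R ?N t) (at t)" if "t \<in> I" for t
    using smooth_on_has_vderiv(2)[OF sm that] k0[OF that]
    by (simp add: principal_normal_def tangent_def)
  have TN: "?T t \<bullet> ?N t = 0" if "t \<in> I" for t
    using inner_derivative_const[OF op that TT dT[OF that] dT[OF that]] k0[OF that]
    by (simp add: inner_commute)
  have "vderiv (vderiv \<alpha>) s \<noteq> 0" using k0[OF s] by (simp add: curvature_def)
  moreover note d2 = smooth_on_has_vderiv(3)[OF sm s]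
  ultimately have "(\<lambda>t. norm (vderiv (vderiv \<alpha>) t)) differentiable (at s)"
    using differentiable_compose[of norm "vderiv (vderiv \<alpha>)"] differentiable_norm_at by blast
  then have "(\<lambda>t. inverse (curvature \<alpha> t)) differentiable (at s)"
    unfolding curvature_def using k0[OF s] by (intro differentiable_inverse) (auto simp: curvature_def)
  then have "?N differentiable (at s)"
    unfolding principal_normal_def[abs_def] using d2 by (intro differentiable_scaleR) auto
  then obtain N' where dN: "(?N has_vector_derivative N') (at s)"
    by (auto simp: vector_derivative_works)
  have "(?B has_vector_derivative ?T s \<times> N' + (curvature \<alpha> s *\<^sub>R ?N s) \<times> ?N s) (at s)"
    unfolding binormal_def[abs_def]
    by (rule bounded_bilinear.has_vector_derivative[OF _ dT[OF s] dN])
       (simp add: bilinear_conv_bounded_bilinear[symmetric] bilinear_cross)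
  then have dB: "(?B has_vector_derivative ?T s \<times> N') (at s)"
    by (simp add: cross_mult_left)
  have BB: "?B t \<bullet> ?B t = 1" if "t \<in> I" for t
    using TT[OF that] NN[OF that] TN[OF that]
    by (simp add: binormal_def dot_cross inner_commute)
  let ?v = "?T s \<times> N'"
  have vB: "?v \<bullet> ?B s = 0"
    using inner_derivative_const[OF op s BB dB dB] by (simp add: inner_commute)
  have vT: "?v \<bullet> ?T s = 0"
    by (simp add: dot_cross_self inner_commute)
  have "?v = (?v \<bullet> ?N s) *\<^sub>R ?N s"
  proof -
    define w where "w = ?v - (?v \<bullet> ?N s) *\<^sub>R ?N s"
    have "?N s \<bullet> ?T s = 0" using TN[OF s] by (simp add: inner_commute)
    then have wT: "w \<bullet> ?T s = 0"
      unfolding w_def inner_diff_left inner_scaleR_left using vT by simp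
    have wN: "w \<bullet> ?N s = 0"
      unfolding w_def inner_diff_left inner_scaleR_left using NN[OF s] by simp
    have "?N s \<bullet> ?B s = 0" by (simp add: binormal_def dot_cross_self)
    then have wB: "w \<bullet> ?B s = 0"
      unfolding w_def inner_diff_left inner_scaleR_left using vB by simp
    have "w \<times> ?B s = 0"
      using wT wN by (simp add: binormal_def Lagrange)
    then have "norm w ^ 2 * norm (?B s) ^ 2 = 0"
      using norm_and_cross_eq_0 wB BB[OF s] by auto
    then have "w = 0" using BB[OF s] by (auto simp: dot_square_norm)
    then show ?thesis by (simp add: w_def)
  qed
  moreover have "torsion \<alpha> s = - (?v \<bullet> ?N s)"
    using vector_derivative_at[OF dB] by (simp add: torsion_def vderiv_def)
  ultimately show ?thesis using dB by simp
qed

end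

theory Submission
  imports Defs
begin

text \<open>
  Write \<open>X = \<beta>'\<close> for the tangent of \<open>\<beta>\<close>. Since \<open>X\<close> is orthogonal to the principal normal of \<open>\<beta>\<close>,
  which is \<open>B\<close>, the whole situation lives in the plane of \<open>T\<close> and \<open>N\<close>: \<open>X = (X \<bullet> T) T + (X \<bullet> N) N\<close>,
  a unit vector. Its two coordinates carry all the information.

  On one side, \<open>X'\<close> is a multiple of \<open>B\<close>, so differentiating \<open>X \<bullet> T\<close> and \<open>X \<bullet> N\<close> sees only the motion
  of the frame of \<open>\<alpha>\<close>; the pair rotates with angular speed \<open>\<kappa>\<close>, and hence equals
  \<open>(sin \<theta>, cos \<theta>)\<close> for a suitable antiderivative \<open>\<theta>\<close> of \<open>\<kappa>\<close> (\<open>rotating_pair_angle\<close>,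
  \<open>mannheim_angle_exists\<close>). On the other side, differentiating the constant functions \<open>X \<bullet> B = 0\<close>
  and \<open>(X \<times> B) \<bullet> B = 0\<close>, where \<open>X \<times> B\<close> is the binormal of \<open>\<beta>\<close>, gives the curvature and the
  torsion of \<open>\<beta>\<close> as \<open>\<tau> (X \<bullet> N)\<close> and \<open>\<tau> (X \<bullet> T)\<close> (\<open>mannheim_curvature_torsion\<close>).

  So the curvature and torsion of \<open>\<beta>\<close> are \<open>\<tau> cos \<theta>\<close> and \<open>\<tau> sin \<theta>\<close>. The curvature of \<open>\<beta>\<close> does not
  vanish, so neither \<open>\<tau>\<close> nor \<open>cos \<theta>\<close> does; the sum of squares is \<open>\<tau>\<^sup>2\<close>, the quotient is \<open>tan \<theta>\<close>,
  and its derivative \<open>\<kappa> / cos\<^sup>2 \<theta>\<close> yields the formula for \<open>\<kappa>\<close>.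
\<close>

section \<open>The Frenet frame\<close>

lemma frenet_tangent:
  assumes "frenet_curve I \<alpha>" and "s \<in> I"
  shows "(tangent \<alpha> has_vector_derivative curvature \<alpha> s *\<^sub>R principal_normal \<alpha> s) (at s)"
  using assms smooth_on_has_vderiv(2)[of I \<alpha> s]
  by (simp add: frenet_curve_def principal_normal_def tangent_def)

lemma frenet_orthonormal:
  assumes I: "open_interval I" and \<alpha>: "frenet_curve I \<alpha>" and s: "s \<in> I"
  shows "tangent \<alpha> s \<bullet> tangent \<alpha> s = 1"
    and "principal_normal \<alpha> s \<bullet> principal_normal \<alpha> s = 1"
    and "tangent \<alpha> s \<bullet> principal_normal \<alpha> s = 0"
proof -
  have op: "open I" using I by (simp add: open_interval_def)
  have TT: "tangent \<alpha> t \<bullet> tangent \<alpha> t = 1" if "t \<in> I" for t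
    using \<alpha> that by (simp add: frenet_curve_def tangent_def dot_square_norm)
  have k0: "curvature \<alpha> s \<noteq> 0" using \<alpha> s by (simp add: frenet_curve_def)
  show "tangent \<alpha> s \<bullet> tangent \<alpha> s = 1" by (rule TT[OF s])
  show "principal_normal \<alpha> s \<bullet> principal_normal \<alpha> s = 1"
    using k0 by (simp add: principal_normal_def dot_square_norm curvature_def power2_eq_square)
  show "tangent \<alpha> s \<bullet> principal_normal \<alpha> s = 0"
    using inner_derivative_const[OF op s TT frenet_tangent[OF \<alpha> s] frenet_tangent[OF \<alpha> s]] k0
    by (simp add: inner_commute)
qed

lemma frenet_cross:
  assumes "open_interval I" and "frenet_curve I \<alpha>" and "s \<in> I"
  shows "principal_normal \<alpha> s \<times> binormal \<alpha> s = tangent \<alpha> s"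
    and "binormal \<alpha> s \<times> tangent \<alpha> s = principal_normal \<alpha> s"
proof -
  note o = frenet_orthonormal[OF assms]
  show "principal_normal \<alpha> s \<times> binormal \<alpha> s = tangent \<alpha> s"
    using o by (simp add: binormal_def Lagrange inner_commute)
  have "tangent \<alpha> s \<times> binormal \<alpha> s = - principal_normal \<alpha> s"
    using o by (simp add: binormal_def Lagrange)
  then show "binormal \<alpha> s \<times> tangent \<alpha> s = principal_normal \<alpha> s"
    by (metis cross_skew minus_minus)
qed

text \<open>
  The remaining Frenet formula comes from differentiating \<open>N = B \<times> T\<close>, so that the
  differentiability of \<open>N\<close> is inherited from that of \<open>B\<close> and \<open>T\<close>.
\<close>

lemma frenet_principal_normal:
  assumes I: "open_interval I" and \<alpha>: "frenet_curve I \<alpha>" and s: "s \<in> I"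
  shows "(principal_normal \<alpha> has_vector_derivative
           torsion \<alpha> s *\<^sub>R binormal \<alpha> s - curvature \<alpha> s *\<^sub>R tangent \<alpha> s) (at s)"
proof -
  have op: "open I" using I by (simp add: open_interval_def)
  have "((\<lambda>t. binormal \<alpha> t \<times> tangent \<alpha> t) has_vector_derivative
          binormal \<alpha> s \<times> (curvature \<alpha> s *\<^sub>R principal_normal \<alpha> s) +
          (- torsion \<alpha> s *\<^sub>R principal_normal \<alpha> s) \<times> tangent \<alpha> s) (at s)"
    by (rule bounded_bilinear.has_vector_derivative
              [OF _ frenet_binormal[OF I \<alpha> s] frenet_tangent[OF \<alpha> s]])
       (simp add: bilinear_conv_bounded_bilinear[symmetric] bilinear_cross)
  moreover have "binormal \<alpha> s \<times> (curvature \<alpha> s *\<^sub>R principal_normal \<alpha> s) +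
          (- torsion \<alpha> s *\<^sub>R principal_normal \<alpha> s) \<times> tangent \<alpha> s =
        torsion \<alpha> s *\<^sub>R binormal \<alpha> s - curvature \<alpha> s *\<^sub>R tangent \<alpha> s"
  proof -
    have "binormal \<alpha> s \<times> principal_normal \<alpha> s = - tangent \<alpha> s"
      using frenet_cross(1)[OF I \<alpha> s] by (metis cross_skew)
    moreover have "principal_normal \<alpha> s \<times> tangent \<alpha> s = - binormal \<alpha> s"
      unfolding binormal_def by (rule cross_skew)
    ultimately show ?thesis by (simp add: cross_mult_left cross_mult_right)
  qed
  ultimately have "((\<lambda>t. binormal \<alpha> t \<times> tangent \<alpha> t) has_vector_derivative
      torsion \<alpha> s *\<^sub>R binormal \<alpha> s - curvature \<alpha> s *\<^sub>R tangent \<alpha> s) (at s)"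
    by simp
  then show ?thesis
    by (rule has_vector_derivative_transform_within_open[OF _ op s])
       (rule frenet_cross(2)[OF I \<alpha>])
qed

text \<open>
  The difference of the two sides is orthogonal to \<open>T\<close> and \<open>N\<close>, hence parallel to \<open>B = T \<times> N\<close>,
  and it is orthogonal to \<open>B\<close> as well.
\<close>

lemma frenet_plane_expansion:
  assumes I: "open_interval I" and \<alpha>: "frenet_curve I \<alpha>" and s: "s \<in> I"
    and B: "v \<bullet> binormal \<alpha> s = 0"
  shows "v = (v \<bullet> tangent \<alpha> s) *\<^sub>R tangent \<alpha> s
             + (v \<bullet> principal_normal \<alpha> s) *\<^sub>R principal_normal \<alpha> s"
proof -
  let ?T = "tangent \<alpha> s" and ?N = "principal_normal \<alpha> s" and ?B = "binormal \<alpha> s"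
  note o = frenet_orthonormal[OF I \<alpha> s]
  define w where "w = v - ((v \<bullet> ?T) *\<^sub>R ?T + (v \<bullet> ?N) *\<^sub>R ?N)"
  have "w \<bullet> ?T = 0" "w \<bullet> ?N = 0"
    using o by (simp_all add: w_def inner_diff_left inner_add_left inner_commute[of ?N ?T])
  then have "w \<times> ?B = 0" by (simp add: binormal_def Lagrange)
  moreover have "w \<bullet> ?B = 0"
    using B by (simp add: w_def inner_diff_left inner_add_left binormal_def dot_cross_self)
  moreover have "?B \<noteq> 0"
    using frenet_cross(2)[OF I \<alpha> s] o(2) by auto
  ultimately have "w = 0" using norm_and_cross_eq_0 by blast
  then show ?thesis by (simp add: w_def)
qed

lemma curvature_continuous:
  assumes \<alpha>: "frenet_curve I \<alpha>" and s: "s \<in> I"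
  shows "isCont (curvature \<alpha>) s"
proof -
  have "vderiv (vderiv \<alpha>) differentiable (at s)"
    using \<alpha> s smooth_on_has_vderiv(3) by (auto simp: frenet_curve_def)
  then have "isCont (vderiv (vderiv \<alpha>)) s" by (rule differentiable_imp_continuous_within)
  then show ?thesis unfolding curvature_def[abs_def] by (intro continuous_norm)
qed

section \<open>Rotating pairs of functions\<close>

text \<open>
  Extended real end points give access to antiderivatives on open intervals that may be unbounded.
\<close>

lemma open_interval_eq_einterval:
  assumes "open_interval I"
  obtains a b where "a < b" "I = einterval a b"
proof
  let ?a = "Inf (ereal ` I)" and ?b = "Sup (ereal ` I)"
  have op: "open I" and iv: "is_interval I" and ne: "I \<noteq> {}"
    using assms by (auto simp: open_interval_def)
  have in_ab: "?a < ereal x \<and> ereal x < ?b" if x: "x \<in> I" for x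
  proof -
    obtain e where e: "e > 0" "ball x e \<subseteq> I" using op x open_contains_ball by blast
    have "x - e/2 \<in> ball x e" "x + e/2 \<in> ball x e" using e(1) by (auto simp: dist_real_def)
    then have I2: "x - e/2 \<in> I" "x + e/2 \<in> I" using e(2) by blast+
    have "?a \<le> ereal (x - e/2)" using I2 by (auto intro: Inf_lower)
    also have "\<dots> < ereal x" using e(1) by simp
    finally have 1: "?a < ereal x" .
    have "ereal x < ereal (x + e/2)" using e(1) by simp
    also have "\<dots> \<le> ?b" using I2 by (auto intro: Sup_upper)
    finally show ?thesis using 1 by blast
  qed
  show "?a < ?b" using ne in_ab less_trans by blast
  show "I = einterval ?a ?b"
  proof (intro set_eqI iffI)
    fix x assume "x \<in> I" then show "x \<in> einterval ?a ?b"
      using in_ab by (simp add: einterval_def)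
  next
    fix x assume "x \<in> einterval ?a ?b"
    then obtain u v where "u \<in> I" "u < x" "v \<in> I" "x < v"
      by (auto simp: einterval_def Inf_less_iff less_Sup_iff)
    then show "x \<in> I" using iv unfolding is_interval_1 by (meson less_imp_le)
  qed
qed

lemma open_interval_antiderivative:
  fixes f :: "real \<Rightarrow> real"
  assumes I: "open_interval I" and f: "\<And>t. t \<in> I \<Longrightarrow> isCont f t"
  obtains F where "\<And>t. t \<in> I \<Longrightarrow> (F has_real_derivative f t) (at t)"
proof -
  obtain a b where ab: "a < b" "I = einterval a b" using open_interval_eq_einterval[OF I] .
  then show ?thesis
    using einterval_antiderivative[of a b f] f that
    by (auto simp: einterval_def has_real_derivative_iff_has_vector_derivative)
qed

lemma open_interval_constant:
  fixes f :: "real \<Rightarrow> real"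
  assumes I: "open_interval I" and f: "\<And>t. t \<in> I \<Longrightarrow> (f has_real_derivative 0) (at t)"
    and "s \<in> I" "t \<in> I"
  shows "f s = f t"
proof -
  have "convex I" using I by (simp add: open_interval_def is_interval_convex)
  then obtain c where "\<And>x. x \<in> I \<Longrightarrow> f x = c"
    using has_field_derivative_zero_constant[of I f] f
    by (meson has_field_derivative_at_within)
  then show ?thesis using assms(3,4) by simp
qed

text \<open>
  The initial value of the antiderivative is chosen so that the angle is right at one point.
  The two unit vectors \<open>(a, b)\<close> and \<open>(sin \<theta>, cos \<theta>)\<close> rotate with the same speed, so their inner
  product is constant; being 1 at that point, it is 1 everywhere, and the vectors agree.
\<close>

lemma rotating_pair_angle:
  fixes a b k :: "real \<Rightarrow> real"
  assumes I: "open_interval I" and k: "\<And>t. t \<in> I \<Longrightarrow> isCont k t"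
    and a: "\<And>t. t \<in> I \<Longrightarrow> (a has_real_derivative k t * b t) (at t)"
    and b: "\<And>t. t \<in> I \<Longrightarrow> (b has_real_derivative - k t * a t) (at t)"
    and unit: "\<And>t. t \<in> I \<Longrightarrow> (a t)\<^sup>2 + (b t)\<^sup>2 = 1"
  obtains \<theta> where "\<And>t. t \<in> I \<Longrightarrow> (\<theta> has_real_derivative k t) (at t)"
    and "\<And>t. t \<in> I \<Longrightarrow> a t = sin (\<theta> t)" and "\<And>t. t \<in> I \<Longrightarrow> b t = cos (\<theta> t)"
proof -
  obtain s where s: "s \<in> I" using I by (auto simp: open_interval_def)
  obtain F where F: "\<And>t. t \<in> I \<Longrightarrow> (F has_real_derivative k t) (at t)"
    using open_interval_antiderivative[OF I k] by blast
  have "(b s)\<^sup>2 + (a s)\<^sup>2 = 1" using unit[OF s] by simp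
  then obtain u where u: "b s = cos u" "a s = sin u"
    using sincos_total_2pi by metis
  define \<theta> where "\<theta> t = F t - F s + u" for t
  have d\<theta>: "(\<theta> has_real_derivative k t) (at t)" if "t \<in> I" for t
    unfolding \<theta>_def by (auto intro!: derivative_eq_intros F that)
  let ?p = "\<lambda>t. a t * sin (\<theta> t) + b t * cos (\<theta> t)"
  have dp: "(?p has_real_derivative 0) (at t)" if "t \<in> I" for t
    by (rule derivative_eq_intros a b d\<theta> that refl)+ (simp add: algebra_simps)
  have "?p s = 1" by (simp add: \<theta>_def u power2_eq_square[symmetric])
  then have p: "?p t = 1" if "t \<in> I" for t
    using open_interval_constant[OF I dp s that] by simp
  have eq: "a t = sin (\<theta> t) \<and> b t = cos (\<theta> t)" if "t \<in> I" for t
  proof -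
    have "(a t - sin (\<theta> t))\<^sup>2 + (b t - cos (\<theta> t))\<^sup>2
        = ((a t)\<^sup>2 + (b t)\<^sup>2) + ((sin (\<theta> t))\<^sup>2 + (cos (\<theta> t))\<^sup>2) - 2 * ?p t"
      by (simp add: power2_eq_square algebra_simps)
    also have "\<dots> = 0" by (simp only: unit[OF that] p[OF that] sin_cos_squared_add)
    finally show ?thesis by (simp add: sum_power2_eq_zero_iff)
  qed
  show ?thesis using that d\<theta> eq by blast
qed

section \<open>Mannheim-direction curves\<close>

lemma mannheim_tangent_binormal:
  assumes "open_interval I" and "mannheim_direction_curve I \<alpha> \<beta>" and "s \<in> I"
  shows "tangent \<beta> s \<bullet> binormal \<alpha> s = 0"
  using assms frenet_orthonormal(3)[of I \<beta> s] by (auto simp: mannheim_direction_curve_def)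

lemma mannheim_tangent:
  assumes "mannheim_direction_curve I \<alpha> \<beta>" and "s \<in> I"
  shows "(tangent \<beta> has_vector_derivative curvature \<beta> s *\<^sub>R binormal \<alpha> s) (at s)"
  using assms frenet_tangent[of I \<beta> s] by (auto simp: mannheim_direction_curve_def)

text \<open>
  Both identities arise by differentiating an orthogonality relation with \<open>B\<close>, once for the
  tangent and once for the binormal of \<open>\<beta>\<close>: on one side the Frenet formulas of \<open>\<beta>\<close> enter through
  the shared vector \<open>B\<close>, on the other side \<open>B' = - \<tau> N\<close>. No absolute value appears: as curvatures are
  nonnegative, the first identity forces \<open>\<beta>' \<bullet> N\<close> and \<open>\<tau>\<close> to have the same sign.
\<close>

lemma mannheim_curvature_torsion:
  assumes I: "open_interval I" and \<alpha>: "frenet_curve I \<alpha>"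
    and \<beta>: "mannheim_direction_curve I \<alpha> \<beta>" and s: "s \<in> I"
  shows "curvature \<beta> s = torsion \<alpha> s * (tangent \<beta> s \<bullet> principal_normal \<alpha> s)"
    and "torsion \<beta> s = torsion \<alpha> s * (tangent \<beta> s \<bullet> tangent \<alpha> s)"
proof -
  have op: "open I" using I by (simp add: open_interval_def)
  have f\<beta>: "frenet_curve I \<beta>" and N: "\<And>t. t \<in> I \<Longrightarrow> principal_normal \<beta> t = binormal \<alpha> t"
    using \<beta> by (auto simp: mannheim_direction_curve_def)
  note dB = frenet_binormal[OF I \<alpha> s]
  have BB: "binormal \<alpha> s \<bullet> binormal \<alpha> s = 1"
    using frenet_orthonormal(2)[OF I f\<beta> s] by (simp add: N s)
  show "curvature \<beta> s = torsion \<alpha> s * (tangent \<beta> s \<bullet> principal_normal \<alpha> s)"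
    using inner_derivative_const[OF op s mannheim_tangent_binormal[OF I \<beta>]
        mannheim_tangent[OF \<beta> s] dB] BB
    by simp
  have perp: "binormal \<beta> t \<bullet> binormal \<alpha> t = 0" if "t \<in> I" for t
    using N[OF that] by (simp add: binormal_def[of \<beta>] dot_cross_self)
  have "torsion \<beta> s = - torsion \<alpha> s * (binormal \<beta> s \<bullet> principal_normal \<alpha> s)"
    using inner_derivative_const[OF op s perp frenet_binormal[OF I f\<beta> s] dB] BB
    by (simp add: N s)
  moreover have "binormal \<beta> s \<bullet> principal_normal \<alpha> s = - (tangent \<beta> s \<bullet> tangent \<alpha> s)"
  proof -
    have "(tangent \<beta> s \<times> binormal \<alpha> s) \<bullet> principal_normal \<alpha> s
        = tangent \<beta> s \<bullet> (binormal \<alpha> s \<times> principal_normal \<alpha> s)"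
      by (metis cross_triple inner_commute)
    also have "binormal \<alpha> s \<times> principal_normal \<alpha> s = - tangent \<alpha> s"
      using frenet_cross(1)[OF I \<alpha> s] by (metis cross_skew)
    finally show ?thesis by (simp add: binormal_def[of \<beta>] N s)
  qed
  ultimately show "torsion \<beta> s = torsion \<alpha> s * (tangent \<beta> s \<bullet> tangent \<alpha> s)" by simp
qed

lemma mannheim_angle_exists:
  assumes I: "open_interval I" and \<alpha>: "frenet_curve I \<alpha>"
    and \<beta>: "mannheim_direction_curve I \<alpha> \<beta>"
  obtains \<theta> where "mannheim_angle I \<alpha> \<beta> \<theta>"
proof -
  let ?a = "\<lambda>t. tangent \<beta> t \<bullet> tangent \<alpha> t"
  let ?b = "\<lambda>t. tangent \<beta> t \<bullet> principal_normal \<alpha> t"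
  have f\<beta>: "frenet_curve I \<beta>" using \<beta> by (simp add: mannheim_direction_curve_def)
  have da: "(?a has_real_derivative curvature \<alpha> t * ?b t) (at t)" if t: "t \<in> I" for t
  proof -
    have "(?a has_vector_derivative
        tangent \<beta> t \<bullet> (curvature \<alpha> t *\<^sub>R principal_normal \<alpha> t)
        + (curvature \<beta> t *\<^sub>R binormal \<alpha> t) \<bullet> tangent \<alpha> t) (at t)"
      by (rule bounded_bilinear.has_vector_derivative[OF bounded_bilinear_inner
            mannheim_tangent[OF \<beta> t] frenet_tangent[OF \<alpha> t]])
    moreover have "binormal \<alpha> t \<bullet> tangent \<alpha> t = 0" by (simp add: binormal_def dot_cross_self)
    ultimately show ?thesis by (simp add: has_real_derivative_iff_has_vector_derivative)
  qed
  have db: "(?b has_real_derivative - curvature \<alpha> t * ?a t) (at t)" if t: "t \<in> I" for t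
  proof -
    have "(?b has_vector_derivative
        tangent \<beta> t \<bullet> (torsion \<alpha> t *\<^sub>R binormal \<alpha> t - curvature \<alpha> t *\<^sub>R tangent \<alpha> t)
        + (curvature \<beta> t *\<^sub>R binormal \<alpha> t) \<bullet> principal_normal \<alpha> t) (at t)"
      by (rule bounded_bilinear.has_vector_derivative[OF bounded_bilinear_inner
            mannheim_tangent[OF \<beta> t] frenet_principal_normal[OF I \<alpha> t]])
    moreover have "binormal \<alpha> t \<bullet> principal_normal \<alpha> t = 0"
      by (simp add: binormal_def dot_cross_self)
    ultimately show ?thesis
      using mannheim_tangent_binormal[OF I \<beta> t]
      by (simp add: has_real_derivative_iff_has_vector_derivative inner_diff_right)
  qed
  have X: "tangent \<beta> t = ?a t *\<^sub>R tangent \<alpha> t + ?b t *\<^sub>R principal_normal \<alpha> t" if "t \<in> I" for t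
    by (rule frenet_plane_expansion[OF I \<alpha> that mannheim_tangent_binormal[OF I \<beta> that]])
  have unit: "(?a t)\<^sup>2 + (?b t)\<^sup>2 = 1" if t: "t \<in> I" for t
  proof -
    have "tangent \<beta> t \<bullet> tangent \<beta> t = tangent \<beta> t \<bullet> (?a t *\<^sub>R tangent \<alpha> t + ?b t *\<^sub>R principal_normal \<alpha> t)"
      using X[OF t] by simp
    also have "\<dots> = (?a t)\<^sup>2 + (?b t)\<^sup>2" by (simp add: inner_add_right power2_eq_square)
    finally show ?thesis using frenet_orthonormal(1)[OF I f\<beta> t] by simp
  qed
  obtain \<theta> where \<theta>: "\<And>t. t \<in> I \<Longrightarrow> (\<theta> has_real_derivative curvature \<alpha> t) (at t)"
    "\<And>t. t \<in> I \<Longrightarrow> ?a t = sin (\<theta> t)" "\<And>t. t \<in> I \<Longrightarrow> ?b t = cos (\<theta> t)"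
    using rotating_pair_angle[OF I curvature_continuous[OF \<alpha>] da db unit] by blast
  have "(\<beta> has_vector_derivative
      sin (\<theta> t) *\<^sub>R tangent \<alpha> t + cos (\<theta> t) *\<^sub>R principal_normal \<alpha> t) (at t)" if t: "t \<in> I" for t
  proof -
    have "(\<beta> has_vector_derivative tangent \<beta> t) (at t)"
      using f\<beta> t smooth_on_has_vderiv(1) by (auto simp: frenet_curve_def tangent_def)
    then show ?thesis using X[OF t] by (simp add: \<theta>(2,3)[OF t])
  qed
  then have "mannheim_angle I \<alpha> \<beta> \<theta>" using \<theta>(1) by (simp add: mannheim_angle_def)
  then show ?thesis by (rule that)
qed

lemma mannheim_angle_coordinates:
  assumes I: "open_interval I" and \<alpha>: "frenet_curve I \<alpha>"
    and \<theta>: "mannheim_angle I \<alpha> \<beta> \<theta>" and s: "s \<in> I"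
  shows "tangent \<beta> s \<bullet> tangent \<alpha> s = sin (\<theta> s)"
    and "tangent \<beta> s \<bullet> principal_normal \<alpha> s = cos (\<theta> s)"
proof -
  have "tangent \<beta> s = sin (\<theta> s) *\<^sub>R tangent \<alpha> s + cos (\<theta> s) *\<^sub>R principal_normal \<alpha> s"
    using \<theta> s by (auto simp: mannheim_angle_def tangent_def[of \<beta>] vderiv_def
        intro: vector_derivative_at)
  then show "tangent \<beta> s \<bullet> tangent \<alpha> s = sin (\<theta> s)"
    "tangent \<beta> s \<bullet> principal_normal \<alpha> s = cos (\<theta> s)"
    using frenet_orthonormal[OF I \<alpha> s] by (simp_all add: inner_add_left inner_commute[of "principal_normal \<alpha> s" "tangent \<alpha> s"])
qed

theorem theorem4p5:
  fixes I :: "real set" and \<alpha> \<beta> :: "real \<Rightarrow> real^3"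
  assumes "open_interval I"
    and "frenet_curve I \<alpha>"
    and "mannheim_direction_curve I \<alpha> \<beta>"
  shows "(\<exists>\<theta>. mannheim_angle I \<alpha> \<beta> \<theta>) \<and>
    (\<forall>\<theta>. mannheim_angle I \<alpha> \<beta> \<theta> \<longrightarrow>
      (\<forall>s\<in>I.
        curvature \<beta> s = \<bar>torsion \<alpha> s * cos (\<theta> s)\<bar> \<and>
        torsion \<beta> s = torsion \<alpha> s * sin (\<theta> s) \<and>
        (\<lambda>t. torsion \<beta> t / curvature \<beta> t) differentiable (at s) \<and>
        curvature \<alpha> s =
          \<bar>(curvature \<beta> s)\<^sup>2 / ((curvature \<beta> s)\<^sup>2 + (torsion \<beta> s)\<^sup>2) *
            vderiv (\<lambda>t. torsion \<beta> t / curvature \<beta> t) s\<bar> \<and>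
        \<bar>torsion \<alpha> s\<bar> = sqrt ((curvature \<beta> s)\<^sup>2 + (torsion \<beta> s)\<^sup>2)))"
proof (intro conjI allI impI ballI)
  show "\<exists>\<theta>. mannheim_angle I \<alpha> \<beta> \<theta>" using mannheim_angle_exists[OF assms] by blast
next
  fix \<theta> s assume \<theta>: "mannheim_angle I \<alpha> \<beta> \<theta>" and s: "s \<in> I"
  have op: "open I" using assms(1) by (simp add: open_interval_def)
  have k: "curvature \<beta> t = torsion \<alpha> t * cos (\<theta> t)"
    and tau: "torsion \<beta> t = torsion \<alpha> t * sin (\<theta> t)" if "t \<in> I" for t
    using mannheim_curvature_torsion[OF assms that]
      mannheim_angle_coordinates[OF assms(1,2) \<theta> that] by simp_all
  have nz: "torsion \<alpha> t \<noteq> 0" "cos (\<theta> t) \<noteq> 0" if "t \<in> I" for t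
    using k[OF that] assms(3) that
    by (auto simp: mannheim_direction_curve_def frenet_curve_def)
  have "curvature \<beta> s \<ge> 0" by (simp add: curvature_def)
  then show "curvature \<beta> s = \<bar>torsion \<alpha> s * cos (\<theta> s)\<bar>" using k[OF s] by simp
  show "torsion \<beta> s = torsion \<alpha> s * sin (\<theta> s)" by (rule tau[OF s])
  let ?q = "\<lambda>t. torsion \<beta> t / curvature \<beta> t"
  have "((\<lambda>t. tan (\<theta> t)) has_real_derivative inverse ((cos (\<theta> s))\<^sup>2) * curvature \<alpha> s) (at s)"
    using \<theta> s nz(2)[OF s] by (intro DERIV_chain2[OF DERIV_tan]) (auto simp: mannheim_angle_def)
  then have "((\<lambda>t. tan (\<theta> t)) has_vector_derivative curvature \<alpha> s / (cos (\<theta> s))\<^sup>2) (at s)"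
    by (simp add: has_real_derivative_iff_has_vector_derivative divide_inverse mult.commute)
  then have dq: "(?q has_vector_derivative curvature \<alpha> s / (cos (\<theta> s))\<^sup>2) (at s)"
    by (rule has_vector_derivative_transform_within_open[OF _ op s])
       (simp add: k tau tan_def nz)
  show "?q differentiable (at s)" using dq by (rule differentiableI_vector)
  have sq: "(curvature \<beta> s)\<^sup>2 + (torsion \<beta> s)\<^sup>2 = (torsion \<alpha> s)\<^sup>2"
    using k[OF s] tau[OF s]
    by (simp add: power_mult_distrib flip: distrib_left)
  have "(curvature \<beta> s)\<^sup>2 / ((curvature \<beta> s)\<^sup>2 + (torsion \<beta> s)\<^sup>2) * vderiv ?q s = curvature \<alpha> s"
    using nz[OF s] unfolding sq vderiv_def vector_derivative_at[OF dq]
    by (simp add: k[OF s] power_mult_distrib)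
  moreover have "curvature \<alpha> s \<ge> 0" by (simp add: curvature_def)
  ultimately show "curvature \<alpha> s =
      \<bar>(curvature \<beta> s)\<^sup>2 / ((curvature \<beta> s)\<^sup>2 + (torsion \<beta> s)\<^sup>2) * vderiv ?q s\<bar>"
    by (simp only: abs_of_nonneg)
  show "\<bar>torsion \<alpha> s\<bar> = sqrt ((curvature \<beta> s)\<^sup>2 + (torsion \<beta> s)\<^sup>2)"
    by (simp add: sq)
qed

end
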